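(* Let $X(u,v)=(f(u)\cos\alpha v,f(u)\sin\alpha v,g(u)\cos\beta v,g(u)\sin\beta v)$ be a general rotational surface in $\mathbb R^4$ whose meridians lie in two-dimensional planes, with rates of rotation $\alpha,\beta>0$ and meridian parametrized by arc-length. If $\alpha=\beta$, then the Gaussian curvature $K$ of this surface is constant if and only if: (1) In the case $K=C^2$, $$f(u)=\frac{C_1\sin(Cu)+C_2\cos(Cu)}{\alpha}\cos\phi(u),\quad g(u)=\frac{C_1\sin(Cu)+C_2\cos(Cu)}{\alpha}\sin\phi(u),$$ where $$\phi(u)=\int\frac{\sqrt{1-C^2[C_1\cos(Cu)-C_2\sin(Cu)]^2}}{C_1\sin(Cu)+C_2\cos(Cu)}\,du,$$ and $C_1,C_2$ are constants such that the formula under the integral sign is defined. (2) In the case $K=-C^2$, $$f(u)=\frac{C_1e^{Cu}+C_2e^{-Cu}}{\alpha}\cos\phi(u),\quad g(u)=\frac{C_1e^{Cu}+C_2e^{-Cu}}{\alpha}\sin\phi(u),$$ where $$\phi(u)=\int\frac{\sqrt{1-C^2[C_1e^{Cu}-C_2e^{-Cu}]^2}}{C_1e^{Cu}+C_2e^{-Cu}}\,du,$$ and $C_1,C_2$ are constants such that the formula under the integral sign is defined. (3) In the case $K=0$, $$f(u)=\frac{C_1u+C_2}{\alpha}\cos\phi(u),\quad g(u)=\frac{C_1u+C_2}{\alpha}\sin\phi(u),$$ where $$\phi(u)=\int\frac{\sqrt{1-C_1^2}}{C_1u+C_2}\,du,$$ and $C_1,C_2$ are constants such that $|C_1|\leq1$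 and $C_1u+C_2\neq0$ for all $u\in I$.
   Context: A general rotational surface whose meridians lie in two-dimensional planes in Euclidean $\mathbb R^4$ is defined as follows. Let $\alpha,\beta$ be positive constants (the rates of rotation), and let $r(u)=(f(u),0,g(u),0)$, $u\in I$, be a regular curve (the meridian) in the plane spanned by the first and third standard basis vectors, parametrized by arc-length, with $(f(u))^2+(g(u))^2\neq0$. The curve is rotated in the $(x_1,x_2)$-plane by the angle $\alpha v$ and in the $(x_3,x_4)$-plane by the angle $\beta v$, $v\in\mathbb R$, which gives the surface $X(u,v)=(f(u)\cos\alpha v,f(u)\sin\alpha v,g(u)\cos\beta v,g(u)\sin\beta v)$. The Gaussian curvature $K$ is that of the metric induced on the surface, $C$ is a constant, and the integrals defining $\phi$ are indefinite integrals.
   Formalization: The 1 under each square root is replaced by α², and |C1|≤1 by |C1|≤α in (3), because the printed formulas contradict arc-length parametrization unless α=1; C≠0 is required in (1) and (2), C=0 being case (3). *)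

theory Defs
  imports "HOL-Analysis.Analysis"
begin

text \<open>
  Points of the parameter domain are vectors \<open>p\<close> with \<open>p $ 1 = u\<close> and \<open>p $ 2 = v\<close>.
\<close>

definition partial_deriv :: "2 \<Rightarrow> (real^2 \<Rightarrow> 'a::real_normed_vector) \<Rightarrow> real^2 \<Rightarrow> 'a" where
  "partial_deriv i F p = vector_derivative (\<lambda>t. F (p + t *\<^sub>R axis i 1)) (at 0)"

definition induced_metric :: "(real^2 \<Rightarrow> 'a::real_inner) \<Rightarrow> real^2 \<Rightarrow> real^2^2" where
  "induced_metric X p = (\<chi> i j. partial_deriv i X p \<bullet> partial_deriv j X p)"

definition christoffel :: "(real^2 \<Rightarrow> real^2^2) \<Rightarrow> 2 \<Rightarrow> 2 \<Rightarrow> 2 \<Rightarrow> real^2 \<Rightarrow> real" where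
  "christoffel G k i j p =
     (\<Sum>l\<in>UNIV. matrix_inv (G p) $ k $ l *
        (partial_deriv i (\<lambda>q. G q $ j $ l) p + partial_deriv j (\<lambda>q. G q $ i $ l) p
         - partial_deriv l (\<lambda>q. G q $ i $ j) p)) / 2"

text \<open>
  The \<open>l\<close>-th component of \<open>R(\<partial>\<^sub>i, \<partial>\<^sub>j)\<partial>\<^sub>k\<close>, with the sign convention
  \<open>R(x, y) = \<nabla>\<^sub>x \<nabla>\<^sub>y - \<nabla>\<^sub>y \<nabla>\<^sub>x - \<nabla>\<^sub>[\<^sub>x\<^sub>,\<^sub>y\<^sub>]\<close>, under which
  the round sphere has positive curvature.
\<close>

definition riemann_tensor :: "(real^2 \<Rightarrow> real^2^2) \<Rightarrow> 2 \<Rightarrow> 2 \<Rightarrow> 2 \<Rightarrow> 2 \<Rightarrow> real^2 \<Rightarrow> real" where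
  "riemann_tensor G l i j k p =
     partial_deriv i (christoffel G l j k) p - partial_deriv j (christoffel G l i k) p
     + (\<Sum>m\<in>UNIV. christoffel G m j k p * christoffel G l i m p
                  - christoffel G m i k p * christoffel G l j m p)"

text \<open>\<open>K = \<langle>R(\<partial>\<^sub>1, \<partial>\<^sub>2)\<partial>\<^sub>2, \<partial>\<^sub>1\<rangle> / det G\<close>.\<close>

definition gauss_curvature :: "(real^2 \<Rightarrow> 'a::real_inner) \<Rightarrow> real^2 \<Rightarrow> real" where
  "gauss_curvature X p =
     (let G = induced_metric X in
        (\<Sum>l\<in>UNIV. riemann_tensor G l 1 2 2 p * G p $ l $ 1) / det (G p))"

definition meridian :: "(real \<Rightarrow> real) \<Rightarrow> (real \<Rightarrow> real) \<Rightarrow> real \<Rightarrow> real^4" where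
  "meridian f g u = vector [f u, 0, g u, 0]"

definition rotational_surface ::
  "real \<Rightarrow> real \<Rightarrow> (real \<Rightarrow> real) \<Rightarrow> (real \<Rightarrow> real) \<Rightarrow> real^2 \<Rightarrow> real^4" where
  "rotational_surface \<alpha> \<beta> f g p =
     vector [f (p $ 1) * cos (\<alpha> * p $ 2), f (p $ 1) * sin (\<alpha> * p $ 2),
             g (p $ 1) * cos (\<beta> * p $ 2), g (p $ 1) * sin (\<beta> * p $ 2)]"

text \<open>
  Twice continuous differentiability is all that the curvature needs: the metric coefficients
  of a unit-speed meridian are \<open>1\<close>, \<open>0\<close> and \<open>\<alpha>\<^sup>2 f\<^sup>2 + \<beta>\<^sup>2 g\<^sup>2\<close>.
\<close>

definition C2_on :: "real set \<Rightarrow> (real \<Rightarrow> real) \<Rightarrow> bool" where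
  "C2_on I f \<longleftrightarrow>
     (\<exists>f' f''. (\<forall>u\<in>I. (f has_real_derivative f' u) (at u)) \<and>
               (\<forall>u\<in>I. (f' has_real_derivative f'' u) (at u)) \<and> continuous_on I f'')"

text \<open>
  The curve \<open>(f, g)\<close> has polar form \<open>(R/\<alpha>) (cos \<phi>, sin \<phi>)\<close> where \<open>\<phi>\<close> is an indefinite integral
  of \<open>sqrt S / R\<close> and this integrand is defined on all of \<open>I\<close>. The explicit nonvanishing and
  nonnegativity conditions are needed because division by zero and roots of
  negative numbers are totalised in HOL.

  For \<open>S\<close>, note that unit speed means \<open>(R'/\<alpha>)\<^sup>2 + (R/\<alpha>)\<^sup>2 \<phi>'\<^sup>2 = 1\<close>, that is
  \<open>\<phi>' = \<plusminus> sqrt (\<alpha>\<^sup>2 - R'\<^sup>2) / R\<close>; the radicand is therefore \<open>\<alpha>\<^sup>2 - R'\<^sup>2\<close>, which is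
  \<open>1 - R'\<^sup>2\<close> only if \<open>\<alpha> = 1\<close>. The sign is accounted for by that of \<open>R\<close>,
  since \<open>(-R, \<phi> + \<pi>)\<close> describes the same curve as \<open>(R, \<phi>)\<close>.
\<close>

definition polar_form ::
  "real set \<Rightarrow> real \<Rightarrow> (real \<Rightarrow> real) \<Rightarrow> (real \<Rightarrow> real) \<Rightarrow> (real \<Rightarrow> real) \<Rightarrow> (real \<Rightarrow> real) \<Rightarrow> bool" where
  "polar_form I \<alpha> f g R S \<longleftrightarrow>
     (\<forall>u\<in>I. R u \<noteq> 0 \<and> 0 \<le> S u) \<and>
     (\<exists>\<phi>. (\<forall>u\<in>I. (\<phi> has_real_derivative sqrt (S u) / R u) (at u)) \<and>
          (\<forall>u\<in>I. f u = R u / \<alpha> * cos (\<phi> u) \<and> g u = R u / \<alpha> * sin (\<phi> u)))"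

end

theory Submission
  imports Defs
begin

text \<open>
  For equal rates the induced metric of the surface is \<open>du\<^sup>2 + \<rho>\<^sup>2 dv\<^sup>2\<close> with
  \<open>\<rho>\<^sup>2 = \<alpha>\<^sup>2 (f\<^sup>2 + g\<^sup>2)\<close>, so that \<open>K = -\<rho>''/\<rho>\<close> (\<open>gauss_curvature_equal_rates\<close>). Hence \<open>K = c\<close> holds
  iff \<open>\<rho>'' = -c \<rho>\<close>, and solving this equation yields the radial functions of the three cases.
  Conversely, a polar form with radial function \<open>R/\<alpha>\<close> gives \<open>\<rho>\<^sup>2 = R\<^sup>2\<close>, and \<open>K = c\<close> as soon as
  \<open>R'' = -c R\<close>.

  It remains to find the polar angle \<open>\<phi>\<close> of the meridian. It is an antiderivative of the angular
  velocity \<open>w = (f g' - g f')/(f\<^sup>2 + g\<^sup>2)\<close> (\<open>polar_angle\<close>), and unit speed gives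
  \<open>(\<rho> w)\<^sup>2 = \<alpha>\<^sup>2 - \<rho>'\<^sup>2\<close>. The stated integrand prescribes the sign of \<open>w\<close> once the sign of the
  radial function is fixed, so \<open>w\<close> must not change sign on \<open>I\<close>. Constancy of the curvature
  ensures this: at a zero of \<open>w\<close> the
  slope \<open>\<rho>'\<close> is extremal, so \<open>\<rho>'' = 0\<close> there and \<open>c = 0\<close>; but then \<open>\<rho>'\<close> is constant and \<open>w\<close> vanishes
  identically (\<open>jacobi_slope_extremal\<close>). If \<open>w\<close> is negative, the radial function \<open>-\<rho>\<close> and the
  angle \<open>\<phi> + \<pi>\<close> are used.
\<close>

section \<open>Gaussian curvature of warped product metrics\<close>

lemma partial_deriv_fst:
  fixes F :: "real^2 \<Rightarrow> 'a::real_normed_vector"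
  assumes "open I" "p $ 1 \<in> I"
    and F: "\<And>q. q $ 1 \<in> I \<Longrightarrow> F q = H (q $ 1)"
    and H: "(H has_vector_derivative D) (at (p $ 1))"
  shows "partial_deriv 1 F p = D"
proof -
  let ?S = "(\<lambda>t. p $ 1 + t) -` I"
  have "((\<lambda>t. p $ 1 + t) has_vector_derivative 1) (at 0)"
    by (auto intro!: derivative_eq_intros)
  then have "((H \<circ> (\<lambda>t. p $ 1 + t)) has_vector_derivative (1 *\<^sub>R D)) (at 0)"
    using H by (intro vector_diff_chain_at) auto
  then have "((\<lambda>t. F (p + t *\<^sub>R axis 1 1)) has_vector_derivative (1 *\<^sub>R D)) (at 0)"
  proof (rule has_vector_derivative_transform_within_open)
    show "open ?S"
      using \<open>open I\<close> by (intro open_vimage continuous_intros)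
    show "0 \<in> ?S" using assms by simp
    show "(H \<circ> (\<lambda>t. p $ 1 + t)) t = F (p + t *\<^sub>R axis 1 1)" if "t \<in> ?S" for t
      using that by (subst F) auto
  qed
  then show ?thesis
    unfolding partial_deriv_def by (simp add: vector_derivative_at)
qed

lemma partial_deriv_snd:
  fixes F :: "real^2 \<Rightarrow> 'a::real_normed_vector"
  assumes "p $ 1 \<in> I" and F: "\<And>q. q $ 1 \<in> I \<Longrightarrow> F q = H (q $ 1)"
  shows "partial_deriv 2 F p = 0"
proof -
  have "F (p + t *\<^sub>R axis 2 1) = H (p $ 1)" for t
    using assms by (subst F) (auto simp: axis_def)
  then show ?thesis
    unfolding partial_deriv_def by (simp add: vector_derivative_const_at)
qed

lemma matrix_inv_diag_2:
  fixes A :: "real^2^2"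
  assumes "A $ 1 $ 1 = 1" "A $ 1 $ 2 = 0" "A $ 2 $ 1 = 0" "A $ 2 $ 2 = d" "d \<noteq> 0"
  shows "matrix_inv A $ 1 $ 1 = 1" "matrix_inv A $ 1 $ 2 = 0"
    "matrix_inv A $ 2 $ 1 = 0" "matrix_inv A $ 2 $ 2 = inverse d"
proof -
  let ?B = "vector [vector [1, 0], vector [0, inverse d]] :: real^2^2"
  have "A ** ?B = mat 1 \<and> ?B ** A = mat 1"
    using assms by (simp add: vec_eq_iff forall_2 matrix_matrix_mult_def sum_2 mat_def)
  then have "A ** matrix_inv A = mat 1 \<and> matrix_inv A ** A = mat 1"
    unfolding matrix_inv_def by (rule someI)
  then have "A ** matrix_inv A = mat 1" ..
  then show "matrix_inv A $ 1 $ 1 = 1" "matrix_inv A $ 1 $ 2 = 0"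
    "matrix_inv A $ 2 $ 1 = 0" "matrix_inv A $ 2 $ 2 = inverse d"
    using assms
    by (simp_all add: vec_eq_iff forall_2 matrix_matrix_mult_def sum_2 mat_def field_simps)
qed

text \<open>
  For the metric \<open>du\<^sup>2 + \<rho>(u)\<^sup>2 dv\<^sup>2\<close> the only nonzero Christoffel symbols are
  \<open>\<Gamma>\<^sup>1\<^sub>2\<^sub>2 = -\<rho>\<rho>'\<close> and \<open>\<Gamma>\<^sup>2\<^sub>1\<^sub>2 = \<Gamma>\<^sup>2\<^sub>2\<^sub>1 = \<rho>'/\<rho>\<close>, which gives \<open>K = -\<rho>''/\<rho>\<close>. The function \<open>\<rho>\<close>
  may be negative: only \<open>\<rho>\<^sup>2\<close> enters the metric.
\<close>

lemma gauss_curvature_warped: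
  fixes X :: "real^2 \<Rightarrow> 'a::real_inner"
  assumes I: "open I" "p $ 1 \<in> I"
    and G: "\<And>q. q $ 1 \<in> I \<Longrightarrow> induced_metric X q $ 1 $ 1 = 1"
      "\<And>q. q $ 1 \<in> I \<Longrightarrow> induced_metric X q $ 1 $ 2 = 0"
      "\<And>q. q $ 1 \<in> I \<Longrightarrow> induced_metric X q $ 2 $ 1 = 0"
      "\<And>q. q $ 1 \<in> I \<Longrightarrow> induced_metric X q $ 2 $ 2 = (\<rho> (q $ 1))\<^sup>2"
    and nz: "\<And>u. u \<in> I \<Longrightarrow> \<rho> u \<noteq> 0"
    and d1: "\<And>u. u \<in> I \<Longrightarrow> (\<rho> has_real_derivative \<rho>1 u) (at u)"
    and d2: "\<And>u. u \<in> I \<Longrightarrow> (\<rho>1 has_real_derivative \<rho>2 u) (at u)"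
  shows "gauss_curvature X p = - \<rho>2 (p $ 1) / \<rho> (p $ 1)"
proof -
  let ?G = "induced_metric X"
  note inv = matrix_inv_diag_2[OF G]
  have D11: "partial_deriv i (\<lambda>q. ?G q $ 1 $ 1) q = 0"
    and D12: "partial_deriv i (\<lambda>q. ?G q $ 1 $ 2) q = 0"
    and D21: "partial_deriv i (\<lambda>q. ?G q $ 2 $ 1) q = 0"
    and D2: "partial_deriv 2 (\<lambda>q. ?G q $ 2 $ 2) q = 0"
    and D1: "partial_deriv 1 (\<lambda>q. ?G q $ 2 $ 2) q = 2 * \<rho> (q $ 1) * \<rho>1 (q $ 1)"
    if q: "q $ 1 \<in> I" for i :: 2 and q
  proof -
    have c: "partial_deriv i (\<lambda>q. ?G q $ a $ b) q = 0"
      if "\<And>q. q $ 1 \<in> I \<Longrightarrow> ?G q $ a $ b = k" for a b k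
      using partial_deriv_fst[where H = "\<lambda>_. k" and D = 0, OF I(1) q that has_vector_derivative_const]
        partial_deriv_snd[where H = "\<lambda>_. k", OF q that] exhaust_2[of i]
      by auto
    show "partial_deriv i (\<lambda>q. ?G q $ 1 $ 1) q = 0"
      "partial_deriv i (\<lambda>q. ?G q $ 1 $ 2) q = 0"
      "partial_deriv i (\<lambda>q. ?G q $ 2 $ 1) q = 0"
      by (rule c, erule G)+
    show "partial_deriv 2 (\<lambda>q. ?G q $ 2 $ 2) q = 0"
      by (rule partial_deriv_snd[where F = "\<lambda>q. ?G q $ 2 $ 2" and H = "\<lambda>u. (\<rho> u)\<^sup>2", OF q G(4)])
    have "((\<lambda>u. (\<rho> u)\<^sup>2) has_vector_derivative 2 * \<rho> (q $ 1) * \<rho>1 (q $ 1)) (at (q $ 1))"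
      unfolding has_real_derivative_iff_has_vector_derivative[symmetric]
      using q by (auto intro!: derivative_eq_intros d1)
    then show "partial_deriv 1 (\<lambda>q. ?G q $ 2 $ 2) q = 2 * \<rho> (q $ 1) * \<rho>1 (q $ 1)"
      by (rule partial_deriv_fst[where H = "\<lambda>u. (\<rho> u)\<^sup>2", OF I(1) q, rotated]) (rule G(4))
  qed
  have \<Gamma>: "christoffel ?G 1 1 1 q = 0" "christoffel ?G 1 1 2 q = 0"
    "christoffel ?G 1 2 1 q = 0" "christoffel ?G 2 1 1 q = 0" "christoffel ?G 2 2 2 q = 0"
    "christoffel ?G 1 2 2 q = - \<rho> (q $ 1) * \<rho>1 (q $ 1)"
    "christoffel ?G 2 1 2 q = \<rho>1 (q $ 1) / \<rho> (q $ 1)"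
    "christoffel ?G 2 2 1 q = \<rho>1 (q $ 1) / \<rho> (q $ 1)" if q: "q $ 1 \<in> I" for q
    using nz[OF q]
    by (simp_all add: christoffel_def sum_2 inv[OF q q q q] D11[OF q] D12[OF q] D21[OF q]
        D1[OF q] D2[OF q] field_simps power2_eq_square)
  have "((\<lambda>u. - \<rho> u * \<rho>1 u) has_vector_derivative
          - (\<rho>1 (p $ 1))\<^sup>2 - \<rho> (p $ 1) * \<rho>2 (p $ 1)) (at (p $ 1))"
    unfolding has_real_derivative_iff_has_vector_derivative[symmetric]
    by (rule derivative_eq_intros d1[OF I(2)] d2[OF I(2)] | simp add: power2_eq_square)+
  then have \<Gamma>1: "partial_deriv 1 (christoffel ?G 1 2 2) p
      = - (\<rho>1 (p $ 1))\<^sup>2 - \<rho> (p $ 1) * \<rho>2 (p $ 1)"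
    by (rule partial_deriv_fst[where H = "\<lambda>u. - \<rho> u * \<rho>1 u", OF I, rotated]) (rule \<Gamma>(6))
  have \<Gamma>2: "partial_deriv 2 (christoffel ?G 1 1 2) p = 0"
    by (rule partial_deriv_snd[where H = "\<lambda>_. 0", OF I(2) \<Gamma>(2)])
  have "riemann_tensor ?G 1 1 2 2 p = - \<rho> (p $ 1) * \<rho>2 (p $ 1)"
    using nz[OF I(2)]
    by (simp add: riemann_tensor_def sum_2 \<Gamma>1 \<Gamma>2 \<Gamma>[OF I(2)] power2_eq_square)
  then show ?thesis
    using nz[OF I(2)]
    by (simp add: gauss_curvature_def Let_def sum_2 G[OF I(2)] det_2 power2_eq_square)
qed

section \<open>The induced metric of a rotational surface\<close>

lemma vector_4_axis:
  "(vector [a, b, c, d] :: real^4)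
    = a *\<^sub>R axis 1 1 + b *\<^sub>R axis 2 1 + c *\<^sub>R axis 3 1 + d *\<^sub>R axis 4 1"
  by (simp add: vec_eq_iff forall_4 vector_def axis_def)

lemma has_vector_derivative_vector_4:
  assumes "(a has_real_derivative a') (at x within S)" "(b has_real_derivative b') (at x within S)"
    "(c has_real_derivative c') (at x within S)" "(d has_real_derivative d') (at x within S)"
  shows "((\<lambda>t. vector [a t, b t, c t, d t] :: real^4) has_vector_derivative
           vector [a', b', c', d']) (at x within S)"
  unfolding vector_4_axis
proof -
  have scale: "((\<lambda>t. h t *\<^sub>R v) has_vector_derivative h' *\<^sub>R v) (at x within S)"
    if "(h has_real_derivative h') (at x within S)" for h h' and v :: "real^4"
    using has_vector_derivative_scaleR[OF that has_vector_derivative_const[of v]] by simp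
  show "((\<lambda>t. a t *\<^sub>R axis 1 1 + b t *\<^sub>R axis 2 1 + c t *\<^sub>R axis 3 1 + d t *\<^sub>R axis 4 1 :: real^4)
      has_vector_derivative a' *\<^sub>R axis 1 1 + b' *\<^sub>R axis 2 1 + c' *\<^sub>R axis 3 1 + d' *\<^sub>R axis 4 1) (at x within S)"
    by (intro has_vector_derivative_add scale assms)
qed

lemma inner_vector_4:
  "(vector [a, b, c, d] :: real^4) \<bullet> vector [a', b', c', d'] = a * a' + b * b' + c * c' + d * d'"
  by (simp add: inner_vec_def sum_4 vector_def)

lemma unit_speed_meridian:
  assumes "(f has_real_derivative f') (at u)" "(g has_real_derivative g') (at u)"
    and "norm (vector_derivative (meridian f g) (at u)) = 1"
  shows "f'\<^sup>2 + g'\<^sup>2 = 1"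
proof -
  have "(meridian f g has_vector_derivative vector [f', 0, g', 0]) (at u)"
    unfolding meridian_def[abs_def]
    by (rule has_vector_derivative_vector_4) (auto intro: assms DERIV_const)
  then show ?thesis
    using assms(3) by (simp add: vector_derivative_at norm_eq_1 inner_vector_4 power2_eq_square)
qed

lemma induced_metric_rotational_surface:
  fixes a b f g f' g' p
  defines "A \<equiv> induced_metric (rotational_surface a b f g) p"
  assumes "(f has_real_derivative f') (at (p $ 1))" "(g has_real_derivative g') (at (p $ 1))"
  shows "A $ 1 $ 1 = f'\<^sup>2 + g'\<^sup>2" "A $ 1 $ 2 = 0" "A $ 2 $ 1 = 0"
    "A $ 2 $ 2 = a\<^sup>2 * (f (p $ 1))\<^sup>2 + b\<^sup>2 * (g (p $ 1))\<^sup>2"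
proof -
  let ?u = "p $ 1" and ?v = "p $ 2" and ?X = "rotational_surface a b f g"
  have "((\<lambda>t. f (?u + t)) has_real_derivative f') (at 0)"
    "((\<lambda>t. g (?u + t)) has_real_derivative g') (at 0)"
    using assms by (simp_all add: DERIV_at_within_shift[where z = ?u and x = 0 and S = UNIV, simplified])
  then have "((\<lambda>t. ?X (p + t *\<^sub>R axis 1 1)) has_vector_derivative
      vector [f' * cos (a * ?v), f' * sin (a * ?v), g' * cos (b * ?v), g' * sin (b * ?v)]) (at 0)"
    unfolding rotational_surface_def
    by (intro has_vector_derivative_vector_4) (auto simp: axis_def intro!: derivative_eq_intros)
  then have X1: "partial_deriv 1 ?X p =
      vector [f' * cos (a * ?v), f' * sin (a * ?v), g' * cos (b * ?v), g' * sin (b * ?v)]"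
    by (simp add: partial_deriv_def vector_derivative_at)
  have "((\<lambda>t. ?X (p + t *\<^sub>R axis 2 1)) has_vector_derivative
      vector [- a * f ?u * sin (a * ?v), a * f ?u * cos (a * ?v),
              - b * g ?u * sin (b * ?v), b * g ?u * cos (b * ?v)]) (at 0)"
    unfolding rotational_surface_def
    by (intro has_vector_derivative_vector_4) (auto simp: axis_def intro!: derivative_eq_intros)
  then have X2: "partial_deriv 2 ?X p =
      vector [- a * f ?u * sin (a * ?v), a * f ?u * cos (a * ?v),
              - b * g ?u * sin (b * ?v), b * g ?u * cos (b * ?v)]"
    by (simp add: partial_deriv_def vector_derivative_at)
  have sc: "(cos (a * ?v))\<^sup>2 + (sin (a * ?v))\<^sup>2 = 1" "(cos (b * ?v))\<^sup>2 + (sin (b * ?v))\<^sup>2 = 1"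
    by simp_all
  have A: "A $ i $ j = partial_deriv i ?X p \<bullet> partial_deriv j ?X p" for i j
    by (simp add: A_def induced_metric_def)
  show "A $ 1 $ 1 = f'\<^sup>2 + g'\<^sup>2"
    unfolding A X1 inner_vector_4 using sc by algebra
  show "A $ 1 $ 2 = 0" "A $ 2 $ 1 = 0"
    unfolding A X1 X2 inner_vector_4 by algebra+
  show "A $ 2 $ 2 = a\<^sup>2 * (f ?u)\<^sup>2 + b\<^sup>2 * (g ?u)\<^sup>2"
    unfolding A X2 inner_vector_4 using sc by algebra
qed

lemma gauss_curvature_equal_rates:
  fixes \<rho> :: "real \<Rightarrow> real"
  assumes I: "open I" "p $ 1 \<in> I"
    and f: "\<And>u. u \<in> I \<Longrightarrow> (f has_real_derivative f1 u) (at u)"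
    and g: "\<And>u. u \<in> I \<Longrightarrow> (g has_real_derivative g1 u) (at u)"
    and unit: "\<And>u. u \<in> I \<Longrightarrow> (f1 u)\<^sup>2 + (g1 u)\<^sup>2 = 1"
    and rho: "\<And>u. u \<in> I \<Longrightarrow> \<alpha>\<^sup>2 * ((f u)\<^sup>2 + (g u)\<^sup>2) = (\<rho> u)\<^sup>2"
    and nz: "\<And>u. u \<in> I \<Longrightarrow> \<rho> u \<noteq> 0"
    and d1: "\<And>u. u \<in> I \<Longrightarrow> (\<rho> has_real_derivative \<rho>1 u) (at u)"
    and d2: "\<And>u. u \<in> I \<Longrightarrow> (\<rho>1 has_real_derivative \<rho>2 u) (at u)"
  shows "gauss_curvature (rotational_surface \<alpha> \<alpha> f g) p = - \<rho>2 (p $ 1) / \<rho> (p $ 1)"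
proof (rule gauss_curvature_warped[OF I _ _ _ _ nz d1 d2])
  fix q :: "real^2" assume q: "q $ 1 \<in> I"
  note G = induced_metric_rotational_surface[where a = \<alpha> and b = \<alpha>, OF f[OF q] g[OF q]]
  show "induced_metric (rotational_surface \<alpha> \<alpha> f g) q $ 1 $ 1 = 1"
    using G(1) unit[OF q] by simp
  show "induced_metric (rotational_surface \<alpha> \<alpha> f g) q $ 1 $ 2 = 0"
    "induced_metric (rotational_surface \<alpha> \<alpha> f g) q $ 2 $ 1 = 0"
    using G(2,3) by simp_all
  show "induced_metric (rotational_surface \<alpha> \<alpha> f g) q $ 2 $ 2 = (\<rho> (q $ 1))\<^sup>2"
    using G(4) rho[OF q] by (simp add: distrib_left)
qed

section \<open>Polar angle of a plane curve\<close>

lemma antiderivative_on_open_interval: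
  fixes w :: "real \<Rightarrow> real"
  assumes "open I" "is_interval I" and w: "continuous_on I w"
  shows "\<exists>\<phi>. \<forall>u\<in>I. (\<phi> has_real_derivative w u) (at u)"
proof (cases "I = {}")
  case True
  then show ?thesis by simp
next
  case False
  then obtain c where "c \<in> I" by blast
  have "((\<lambda>u. LBINT y=c..u. w y) has_real_derivative w u) (at u)" if "u \<in> I" for u
  proof -
    have "min c u \<in> I" "max c u \<in> I"
      using \<open>c \<in> I\<close> that by (auto simp: min_def max_def)
    moreover have "\<exists>d>0. cball x d \<subseteq> I" if "x \<in> I" for x
      using \<open>open I\<close> that by (simp add: open_contains_cball)
    ultimately obtain d e
      where d: "d > 0" "cball (min c u) d \<subseteq> I" and e: "e > 0" "cball (max c u) e \<subseteq> I"
      by meson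
    define a b where "a = min c u - d" and "b = max c u + e"
    have "a \<in> cball (min c u) d" "b \<in> cball (max c u) e"
      using d(1) e(1) by (simp_all add: a_def b_def dist_real_def)
    then have "a \<in> I" "b \<in> I"
      using d(2) e(2) by blast+
    then have sub: "{a..b} \<subseteq> I"
      using mem_is_interval_1_I[OF \<open>is_interval I\<close>] by (meson atLeastAtMost_iff subsetI)
    have ineq: "a < c" "c < b" "a < u" "u < b"
      using d e by (auto simp: a_def b_def)
    have "((\<lambda>u. LBINT y=c..u. w y) has_vector_derivative w u) (at u within {a..b})"
      using ineq by (intro interval_integral_FTC2 continuous_on_subset[OF w sub]) auto
    then show ?thesis
      using ineq by (simp add: has_real_derivative_iff_has_vector_derivative at_within_Icc_at)
  qed
  then show ?thesis by blast
qed

lemma constant_on_open_interval: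
  fixes h :: "real \<Rightarrow> real"
  assumes "is_interval I"
    and "\<And>u. u \<in> I \<Longrightarrow> (h has_real_derivative 0) (at u)"
  shows "\<exists>k. \<forall>u\<in>I. h u = k"
proof (rule has_field_derivative_zero_constant)
  show "convex I" using assms(1) by (rule is_interval_convex)
  show "(h has_real_derivative 0) (at u within I)" if "u \<in> I" for u
    using assms(2)[OF that] by (rule has_field_derivative_at_within)
qed

lemma has_real_derivative_radius:
  fixes f g :: "real \<Rightarrow> real"
  assumes "(f has_real_derivative f') (at u)" "(g has_real_derivative g') (at u)"
    and nz: "(f u)\<^sup>2 + (g u)\<^sup>2 \<noteq> 0"
  shows "((\<lambda>u. sqrt ((f u)\<^sup>2 + (g u)\<^sup>2)) has_real_derivative
           (f u * f' + g u * g') / sqrt ((f u)\<^sup>2 + (g u)\<^sup>2)) (at u)"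
proof -
  let ?n = "(f u)\<^sup>2 + (g u)\<^sup>2"
  have "?n > 0"
    using nz by (simp add: less_le)
  then have deriv: "((\<lambda>u. sqrt ((f u)\<^sup>2 + (g u)\<^sup>2)) has_real_derivative
      (2 * f u * f' + 2 * g u * g') * (inverse (sqrt ?n) / 2)) (at u)"
    by (auto intro!: derivative_eq_intros assms(1,2))
  have "(2 * a * a' + 2 * b * b') * (inverse s / 2) = (a * a' + b * b') / s"
    if "s \<noteq> 0" for a a' b b' s :: real
    using that by (simp add: field_simps)
  then show ?thesis
    by (rule DERIV_cong[OF deriv]) (use nz in simp)
qed

text \<open>
  A polar angle of a plane curve avoiding the origin, as an antiderivative of the angular velocity.
  For any antiderivative \<open>\<psi>\<close> of the angular velocity, rotating the normalised curve back
  by \<open>\<psi>\<close> yields a constant unit vector, whose argument is then added to \<open>\<psi>\<close>.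
\<close>

lemma polar_angle:
  fixes f g f1 g1 :: "real \<Rightarrow> real"
  assumes I: "open I" "is_interval I"
    and f: "\<And>u. u \<in> I \<Longrightarrow> (f has_real_derivative f1 u) (at u)" "continuous_on I f1"
    and g: "\<And>u. u \<in> I \<Longrightarrow> (g has_real_derivative g1 u) (at u)" "continuous_on I g1"
    and nz: "\<And>u. u \<in> I \<Longrightarrow> (f u)\<^sup>2 + (g u)\<^sup>2 \<noteq> 0"
  obtains \<phi> where
    "\<And>u. u \<in> I \<Longrightarrow>
      (\<phi> has_real_derivative (f u * g1 u - g u * f1 u) / ((f u)\<^sup>2 + (g u)\<^sup>2)) (at u)"
    "\<And>u. u \<in> I \<Longrightarrow> f u = sqrt ((f u)\<^sup>2 + (g u)\<^sup>2) * cos (\<phi> u)"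
    "\<And>u. u \<in> I \<Longrightarrow> g u = sqrt ((f u)\<^sup>2 + (g u)\<^sup>2) * sin (\<phi> u)"
proof (cases "I = {}")
  case True
  then show ?thesis using that by blast
next
  case False
  then obtain u0 where u0: "u0 \<in> I" by blast
  define w where "w u = (f u * g1 u - g u * f1 u) / ((f u)\<^sup>2 + (g u)\<^sup>2)" for u
  define r where "r u = sqrt ((f u)\<^sup>2 + (g u)\<^sup>2)" for u
  have r: "r u > 0" "(r u)\<^sup>2 = (f u)\<^sup>2 + (g u)\<^sup>2" if "u \<in> I" for u
  proof -
    have "(f u)\<^sup>2 + (g u)\<^sup>2 > 0"
      using nz[OF that] by (simp add: less_le)
    then show "r u > 0" "(r u)\<^sup>2 = (f u)\<^sup>2 + (g u)\<^sup>2" by (simp_all add: r_def)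
  qed
  have "continuous_on I f" "continuous_on I g"
    using f g by (meson DERIV_isCont continuous_at_imp_continuous_on)+
  then have "continuous_on I w"
    unfolding w_def using f(2) g(2) nz by (intro continuous_intros) auto
  from antiderivative_on_open_interval[OF I this]
  obtain \<psi> where \<psi>: "\<forall>u\<in>I. (\<psi> has_real_derivative w u) (at u)" ..
  have dr: "(r has_real_derivative (f u * f1 u + g u * g1 u) / r u) (at u)" if "u \<in> I" for u
    using has_real_derivative_radius[OF f(1) g(1) nz] that unfolding r_def by blast
  \<comment> \<open>The components of the normalised curve rotated by \<open>-\<psi>\<close>.\<close>
  define P where "P u = (f u * cos (\<psi> u) + g u * sin (\<psi> u)) / r u" for u
  define Q where "Q u = (g u * cos (\<psi> u) - f u * sin (\<psi> u)) / r u" for u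
  \<comment> \<open>The quotient-rule expression for the derivative of \<open>P\<close> (with \<open>c = cos \<psi>\<close>, \<open>s = sin \<psi>\<close>)
    and of \<open>Q\<close> (with \<open>c = - sin \<psi>\<close>, \<open>s = cos \<psi>\<close>) vanishes.\<close>
  have *: "((f1 * c + g1 * s + w * (g * c - f * s)) * r
      - (f * c + g * s) * ((f * f1 + g * g1) / r)) / (r * r) = 0"
    if "r > 0" "r\<^sup>2 = f\<^sup>2 + g\<^sup>2" "w = (f * g1 - g * f1) / (f\<^sup>2 + g\<^sup>2)"
    for f g f1 g1 c s w r :: real
  proof -
    have "w * r\<^sup>2 = f * g1 - g * f1" unfolding that(3) that(2)[symmetric] using that(1) by simp
    then have "(f1 * c + g1 * s + w * (g * c - f * s)) * r\<^sup>2 = (f * c + g * s) * (f * f1 + g * g1)"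
      using that(2) by algebra
    then show ?thesis using that(1) by (simp add: field_simps power2_eq_square)
  qed
  have "(P has_real_derivative 0) (at u)" if u: "u \<in> I" for u
  proof -
    have "(P has_real_derivative
        ((f1 u * cos (\<psi> u) + g1 u * sin (\<psi> u) + w u * (g u * cos (\<psi> u) - f u * sin (\<psi> u))) * r u
          - (f u * cos (\<psi> u) + g u * sin (\<psi> u)) * ((f u * f1 u + g u * g1 u) / r u)) / (r u * r u)) (at u)"
      using r(1)[OF u] unfolding P_def
      by (auto intro!: derivative_eq_intros f(1)[OF u] g(1)[OF u] \<psi>[rule_format, OF u] dr[OF u]
          simp: algebra_simps)
    then show ?thesis by (rule DERIV_cong) (rule *[OF r[OF u] w_def])
  qed
  from constant_on_open_interval[OF I(2) this]
  obtain p where p: "\<forall>u\<in>I. P u = p" ..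
  have "(Q has_real_derivative 0) (at u)" if u: "u \<in> I" for u
  proof -
    have "(Q has_real_derivative
        ((f1 u * - sin (\<psi> u) + g1 u * cos (\<psi> u) + w u * (g u * - sin (\<psi> u) - f u * cos (\<psi> u))) * r u
          - (f u * - sin (\<psi> u) + g u * cos (\<psi> u)) * ((f u * f1 u + g u * g1 u) / r u)) / (r u * r u)) (at u)"
      using r(1)[OF u] unfolding Q_def
      by (auto intro!: derivative_eq_intros f(1)[OF u] g(1)[OF u] \<psi>[rule_format, OF u] dr[OF u]
          simp: algebra_simps)
    then show ?thesis by (rule DERIV_cong) (rule *[OF r[OF u] w_def])
  qed
  from constant_on_open_interval[OF I(2) this]
  obtain q where q: "\<forall>u\<in>I. Q u = q" ..
  have fg: "f u = r u * (p * cos (\<psi> u) - q * sin (\<psi> u))"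
    "g u = r u * (p * sin (\<psi> u) + q * cos (\<psi> u))" if u: "u \<in> I" for u
  proof -
    have "r u * p = f u * cos (\<psi> u) + g u * sin (\<psi> u)"
      "r u * q = g u * cos (\<psi> u) - f u * sin (\<psi> u)"
      using r(1)[OF u] p[rule_format, OF u] q[rule_format, OF u] by (auto simp: P_def Q_def)
    then show "f u = r u * (p * cos (\<psi> u) - q * sin (\<psi> u))"
      "g u = r u * (p * sin (\<psi> u) + q * cos (\<psi> u))"
      using sin_cos_squared_add[of "\<psi> u"] by algebra+
  qed
  have "(r u0)\<^sup>2 * (p\<^sup>2 + q\<^sup>2) = (r u0)\<^sup>2 * 1"
    using fg[OF u0] r(2)[OF u0] sin_cos_squared_add[of "\<psi> u0"] by algebra
  then have "p\<^sup>2 + q\<^sup>2 = 1" using r(1)[OF u0] by simp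
  then obtain \<theta> where \<theta>: "p = cos \<theta>" "q = sin \<theta>"
    using sincos_total_2pi by metis
  show ?thesis
  proof (rule that)
    fix u assume u: "u \<in> I"
    show "((\<lambda>u. \<psi> u + \<theta>) has_real_derivative
        (f u * g1 u - g u * f1 u) / ((f u)\<^sup>2 + (g u)\<^sup>2)) (at u)"
      using \<psi>[rule_format, OF u] by (auto simp: w_def intro!: derivative_eq_intros)
    show "f u = sqrt ((f u)\<^sup>2 + (g u)\<^sup>2) * cos (\<psi> u + \<theta>)"
      "g u = sqrt ((f u)\<^sup>2 + (g u)\<^sup>2) * sin (\<psi> u + \<theta>)"
      using fg[OF u] unfolding r_def[symmetric] cos_add sin_add \<theta> by algebra+
  qed
qed

section \<open>Surfaces of constant curvature and the Jacobi equation\<close>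

text \<open>
  If the slope of a nonvanishing solution of \<open>y'' = -c y\<close> on an open interval attains its bound \<open>a\<close>
  in absolute value at one point, then it does so everywhere: \<open>y'\<^sup>2\<close> has an interior maximum
  there, hence \<open>y' y'' = 0\<close>, which forces \<open>c = 0\<close>, and \<open>y'\<close> is constant. When the distance from
  the origin along a unit-speed curve solves the equation, this says for \<open>a = 1\<close> that the angular
  velocity vanishes either nowhere or identically.
\<close>

lemma jacobi_slope_extremal:
  fixes y y1 :: "real \<Rightarrow> real"
  assumes I: "open I" "is_interval I"
    and y: "\<And>u. u \<in> I \<Longrightarrow> (y has_real_derivative y1 u) (at u)"
      "\<And>u. u \<in> I \<Longrightarrow> (y1 has_real_derivative - c * y u) (at u)"
    and nz: "\<And>u. u \<in> I \<Longrightarrow> y u \<noteq> 0"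
    and "a > 0" and le: "\<And>u. u \<in> I \<Longrightarrow> (y1 u)\<^sup>2 \<le> a\<^sup>2"
    and v: "v \<in> I" "(y1 v)\<^sup>2 = a\<^sup>2" and u: "u \<in> I"
  shows "(y1 u)\<^sup>2 = a\<^sup>2"
proof -
  have "((\<lambda>t. (y1 t)\<^sup>2) has_real_derivative 2 * y1 v * (- c * y v)) (at v)"
    by (auto intro!: derivative_eq_intros y(2)[OF v(1)])
  moreover obtain e where "e > 0" "ball v e \<subseteq> I"
    using I(1) v(1) open_contains_ball by metis
  ultimately have "2 * y1 v * (- c * y v) = 0"
    using le v(2) by (intro DERIV_local_max[where d = e]) (auto simp: dist_real_def subset_iff)
  moreover have "y1 v \<noteq> 0" using v(2) \<open>a > 0\<close> by auto
  ultimately have "c = 0" using nz[OF v(1)] by simp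
  then have "(y1 has_real_derivative 0) (at t)" if "t \<in> I" for t
    using y(2)[OF that] by simp
  from constant_on_open_interval[OF I(2) this]
  obtain k where "\<forall>t\<in>I. y1 t = k" ..
  then show ?thesis using u v by simp
qed

lemma nonvanishing_constant_sign:
  fixes w :: "real \<Rightarrow> real"
  assumes "is_interval I" "continuous_on I w" "\<And>u. u \<in> I \<Longrightarrow> w u \<noteq> 0"
  shows "(\<forall>u\<in>I. 0 < w u) \<or> (\<forall>u\<in>I. w u < 0)"
proof (rule ccontr)
  assume "\<not> ?thesis"
  then obtain a b where ab: "a \<in> I" "b \<in> I" "w a \<le> 0" "0 \<le> w b"
    by (auto simp: not_less)
  have "is_interval (w ` I)"
    using assms(1,2) by (simp add: is_interval_connected_1 connected_continuous_image)
  then have "0 \<in> w ` I"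
    by (rule mem_is_interval_1_I[of _ "w a" "w b"]) (use ab in auto)
  then show False using assms(3) by auto
qed

text \<open>
  The common core of all three cases. In the forward direction \<open>R = \<sigma> \<alpha> sqrt (f\<^sup>2 + g\<^sup>2)\<close>, where
  \<open>\<sigma> = \<plusminus>1\<close> is the sign of the angular velocity of the meridian, and arbitrary if that vanishes.
\<close>

lemma constant_curvature_iff_polar_form:
  fixes f g :: "real \<Rightarrow> real"
  assumes I: "open I" "is_interval I" and "\<alpha> > 0"
    and smooth: "C2_on I f" "C2_on I g"
    and arc_length: "\<And>u. u \<in> I \<Longrightarrow> norm (vector_derivative (meridian f g) (at u)) = 1"
    and off_origin: "\<And>u. u \<in> I \<Longrightarrow> (f u)\<^sup>2 + (g u)\<^sup>2 \<noteq> 0"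
  shows "(\<forall>p. p $ 1 \<in> I \<longrightarrow> gauss_curvature (rotational_surface \<alpha> \<alpha> f g) p = c) \<longleftrightarrow>
    (\<exists>R R1. (\<forall>u\<in>I. (R has_real_derivative R1 u) (at u)
                \<and> (R1 has_real_derivative - c * R u) (at u))
          \<and> polar_form I \<alpha> f g R (\<lambda>u. \<alpha>\<^sup>2 - (R1 u)\<^sup>2))"
    (is "?K \<longleftrightarrow> ?P")
proof -
  obtain f1 f2 where f: "\<And>u. u \<in> I \<Longrightarrow> (f has_real_derivative f1 u) (at u)"
      "\<And>u. u \<in> I \<Longrightarrow> (f1 has_real_derivative f2 u) (at u)"
    using smooth(1) unfolding C2_on_def by auto
  obtain g1 g2 where g: "\<And>u. u \<in> I \<Longrightarrow> (g has_real_derivative g1 u) (at u)"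
      "\<And>u. u \<in> I \<Longrightarrow> (g1 has_real_derivative g2 u) (at u)"
    using smooth(2) unfolding C2_on_def by auto
  have unit: "(f1 u)\<^sup>2 + (g1 u)\<^sup>2 = 1" if "u \<in> I" for u
    by (rule unit_speed_meridian[OF f(1)[OF that] g(1)[OF that] arc_length[OF that]])
  note curvature = gauss_curvature_equal_rates[OF I(1) _ f(1) g(1) unit, where \<alpha> = \<alpha>]
  show ?thesis
  proof
    assume ?P
    then obtain R R1 where R: "\<And>u. u \<in> I \<Longrightarrow> (R has_real_derivative R1 u) (at u)"
        "\<And>u. u \<in> I \<Longrightarrow> (R1 has_real_derivative - c * R u) (at u)"
      and P: "polar_form I \<alpha> f g R (\<lambda>u. \<alpha>\<^sup>2 - (R1 u)\<^sup>2)" by auto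
    have nz: "R u \<noteq> 0" if "u \<in> I" for u
      using P that by (simp add: polar_form_def)
    obtain \<phi> where \<phi>: "\<forall>u\<in>I. f u = R u / \<alpha> * cos (\<phi> u) \<and> g u = R u / \<alpha> * sin (\<phi> u)"
      using P unfolding polar_form_def by auto
    have rho: "\<alpha>\<^sup>2 * ((f u)\<^sup>2 + (g u)\<^sup>2) = (R u)\<^sup>2" if "u \<in> I" for u
    proof -
      have "\<alpha> * f u = R u * cos (\<phi> u)" "\<alpha> * g u = R u * sin (\<phi> u)"
        using \<phi> that \<open>\<alpha> > 0\<close> by auto
      then show ?thesis using sin_cos_squared_add[of "\<phi> u"] by algebra
    qed
    show ?K
    proof (intro allI impI)
      fix p :: "real^2" assume p: "p $ 1 \<in> I"
      show "gauss_curvature (rotational_surface \<alpha> \<alpha> f g) p = c"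
        using curvature[OF p _ _ _ rho nz R] nz[OF p] by simp
    qed
  next
    assume K: ?K
    define r where "r u = sqrt ((f u)\<^sup>2 + (g u)\<^sup>2)" for u
    define r1 where "r1 u = (f u * f1 u + g u * g1 u) / r u" for u
    define r2 where "r2 u = (((f1 u)\<^sup>2 + f u * f2 u + ((g1 u)\<^sup>2 + g u * g2 u)) * r u
        - (f u * f1 u + g u * g1 u) * r1 u) / (r u * r u)" for u
    have r: "r u > 0" "(r u)\<^sup>2 = (f u)\<^sup>2 + (g u)\<^sup>2" if "u \<in> I" for u
    proof -
      have "(f u)\<^sup>2 + (g u)\<^sup>2 > 0"
        using off_origin[OF that] by (simp add: less_le)
      then show "r u > 0" "(r u)\<^sup>2 = (f u)\<^sup>2 + (g u)\<^sup>2" by (simp_all add: r_def)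
    qed
    have dr: "(r has_real_derivative r1 u) (at u)" if u: "u \<in> I" for u
      unfolding r1_def r_def
      by (rule has_real_derivative_radius[OF f(1)[OF u] g(1)[OF u] off_origin[OF u]])
    have dr1: "(r1 has_real_derivative r2 u) (at u)" if u: "u \<in> I" for u
      using r(1)[OF u] unfolding r1_def[abs_def] r2_def
      by (auto intro!: derivative_eq_intros f[OF u] g[OF u] dr[OF u]
          simp: algebra_simps power2_eq_square r1_def)
    have "- (\<alpha> * r2 u) / (\<alpha> * r u) = c" if u: "u \<in> I" for u
    proof -
      let ?p = "vector [u, 0] :: real^2"
      have p: "?p $ 1 \<in> I" using u by simp
      have "gauss_curvature (rotational_surface \<alpha> \<alpha> f g) ?p
          = - (\<alpha> * r2 (?p $ 1)) / (\<alpha> * r (?p $ 1))"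
      proof (rule curvature[OF p])
        fix t assume t: "t \<in> I"
        show "\<alpha>\<^sup>2 * ((f t)\<^sup>2 + (g t)\<^sup>2) = (\<alpha> * r t)\<^sup>2"
          using r(2)[OF t] by (simp add: power_mult_distrib)
        show "\<alpha> * r t \<noteq> 0" using r(1)[OF t] \<open>\<alpha> > 0\<close> by simp
        show "((\<lambda>t. \<alpha> * r t) has_real_derivative \<alpha> * r1 t) (at t)"
          "((\<lambda>t. \<alpha> * r1 t) has_real_derivative \<alpha> * r2 t) (at t)"
          by (intro DERIV_cmult dr dr1 t)+
      qed
      then show ?thesis using K p by simp
    qed
    then have r2: "r2 u = - c * r u" if "u \<in> I" for u
      using that r(1)[OF that] \<open>\<alpha> > 0\<close> by (force simp: field_simps)
    have cont: "continuous_on I f" "continuous_on I f1" "continuous_on I g" "continuous_on I g1"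
      using f g by (meson DERIV_isCont continuous_at_imp_continuous_on)+
    obtain \<phi> where \<phi>: "\<And>u. u \<in> I \<Longrightarrow>
          (\<phi> has_real_derivative (f u * g1 u - g u * f1 u) / ((f u)\<^sup>2 + (g u)\<^sup>2)) (at u)"
        "\<And>u. u \<in> I \<Longrightarrow> f u = r u * cos (\<phi> u)" "\<And>u. u \<in> I \<Longrightarrow> g u = r u * sin (\<phi> u)"
      using polar_angle[OF I f(1) cont(2) g(1) cont(4) off_origin] unfolding r_def by metis
    \<comment> \<open>The angular velocity of the meridian.\<close>
    define w where "w u = (f u * g1 u - g u * f1 u) / ((f u)\<^sup>2 + (g u)\<^sup>2)" for u
    \<comment> \<open>Lagrange's identity and unit speed.\<close>
    have w: "1 - (r1 u)\<^sup>2 = (r u * w u)\<^sup>2" if u: "u \<in> I" for u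
    proof -
      have "r u * r1 u = f u * f1 u + g u * g1 u" "(r u)\<^sup>2 * w u = f u * g1 u - g u * f1 u"
        using r(1)[OF u] unfolding r1_def w_def r(2)[OF u, symmetric] by simp_all
      then have "(r u)\<^sup>2 * (1 - (r1 u)\<^sup>2) = (r u)\<^sup>2 * (r u * w u)\<^sup>2"
        using unit[OF u] r(2)[OF u] by algebra
      then show ?thesis using r(1)[OF u] by simp
    qed
    have "continuous_on I w"
      unfolding w_def using cont off_origin by (intro continuous_intros) auto
    have "\<exists>\<sigma>. (\<sigma> = 1 \<or> \<sigma> = -1) \<and> (\<forall>u\<in>I. \<sigma> * \<bar>w u\<bar> = w u)"
    proof (cases "\<exists>v\<in>I. w v = 0")
      case True
      then obtain v where v: "v \<in> I" "w v = 0" by blast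
      have "(r1 u)\<^sup>2 = 1\<^sup>2" if u: "u \<in> I" for u
      proof (rule jacobi_slope_extremal[OF I dr _ _ _ _ v(1) _ u])
        fix t assume t: "t \<in> I"
        show "(r1 has_real_derivative - c * r t) (at t)" "r t \<noteq> 0"
          using dr1[OF t] r(1)[OF t] by (simp_all add: r2[OF t])
        have "0 \<le> 1 - (r1 t)\<^sup>2" unfolding w[OF t] by simp
        then show "(r1 t)\<^sup>2 \<le> 1\<^sup>2" by simp
      next
        show "(r1 v)\<^sup>2 = 1\<^sup>2" using w[OF v(1)] v(2) by simp
      qed simp_all
      then have "w u = 0" if "u \<in> I" for u
        using w[OF that] r(1)[OF that] that by simp
      then show ?thesis by auto
    next
      case False
      then have "(\<forall>u\<in>I. 0 < w u) \<or> (\<forall>u\<in>I. w u < 0)"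
        by (intro nonvanishing_constant_sign I(2) \<open>continuous_on I w\<close>) auto
      then show ?thesis
      proof
        assume "\<forall>u\<in>I. 0 < w u"
        then show ?thesis by (intro exI[of _ 1]) (simp add: abs_of_pos)
      next
        assume "\<forall>u\<in>I. w u < 0"
        then show ?thesis by (intro exI[of _ "-1"]) (simp add: abs_of_neg)
      qed
    qed
    then obtain \<sigma> :: real where \<sigma>: "\<sigma> = 1 \<or> \<sigma> = -1" "\<And>u. u \<in> I \<Longrightarrow> \<sigma> * \<bar>w u\<bar> = w u"
      by auto
    define R where "R u = \<sigma> * \<alpha> * r u" for u
    define R1 where "R1 u = \<sigma> * \<alpha> * r1 u" for u
    \<comment> \<open>A negative radius is compensated by a half turn.\<close>
    define \<theta> where "\<theta> = (if \<sigma> = 1 then 0 else pi)"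
    have \<theta>: "\<sigma> * cos (x + \<theta>) = cos x" "\<sigma> * sin (x + \<theta>) = sin x" for x
      using \<sigma>(1) by (auto simp: \<theta>_def)
    have \<sigma>2: "\<sigma>\<^sup>2 = 1" "\<sigma> \<noteq> 0" using \<sigma>(1) by auto
    have "polar_form I \<alpha> f g R (\<lambda>u. \<alpha>\<^sup>2 - (R1 u)\<^sup>2)"
      unfolding polar_form_def
    proof (intro conjI ballI exI)
      fix u assume u: "u \<in> I"
      have "\<alpha>\<^sup>2 - (R1 u)\<^sup>2 = \<alpha>\<^sup>2 * (1 - (r1 u)\<^sup>2)"
        using \<sigma>2 by (simp add: R1_def power_mult_distrib right_diff_distrib)
      then have S: "\<alpha>\<^sup>2 - (R1 u)\<^sup>2 = (\<alpha> * r u * w u)\<^sup>2"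
        using w[OF u] by (simp add: power_mult_distrib)
      then show "0 \<le> \<alpha>\<^sup>2 - (R1 u)\<^sup>2" by simp
      show "R u \<noteq> 0" using \<sigma>2 r(1)[OF u] \<open>\<alpha> > 0\<close> by (simp add: R_def)
      have "sqrt (\<alpha>\<^sup>2 - (R1 u)\<^sup>2) / R u = w u"
        using \<sigma> r(1)[OF u] \<open>\<alpha> > 0\<close> u
        by (auto simp: S R_def abs_mult)
      then show "((\<lambda>u. \<phi> u + \<theta>) has_real_derivative sqrt (\<alpha>\<^sup>2 - (R1 u)\<^sup>2) / R u) (at u)"
        using \<phi>(1)[OF u] by (auto simp: w_def intro!: derivative_eq_intros)
      have "R u / \<alpha> = \<sigma> * r u" using \<open>\<alpha> > 0\<close> by (simp add: R_def)
      then show "f u = R u / \<alpha> * cos (\<phi> u + \<theta>)" "g u = R u / \<alpha> * sin (\<phi> u + \<theta>)"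
        using \<phi>(2,3)[OF u] \<theta>[of "\<phi> u"] by algebra+
    qed
    moreover have "(R has_real_derivative R1 u) (at u)"
      "(R1 has_real_derivative - c * R u) (at u)" if u: "u \<in> I" for u
    proof -
      show "(R has_real_derivative R1 u) (at u)"
        unfolding R_def R1_def by (intro DERIV_cmult dr u)
      have "(R1 has_real_derivative \<sigma> * \<alpha> * r2 u) (at u)"
        unfolding R1_def by (intro DERIV_cmult dr1 u)
      then show "(R1 has_real_derivative - c * R u) (at u)"
        by (rule DERIV_cong) (simp add: R_def r2[OF u])
    qed
    ultimately show ?P by blast
  qed
qed

section \<open>Explicit solutions of the Jacobi equation\<close>

text \<open>
  The constant-coefficient equations \<open>y'' = -c y\<close> for \<open>c = C\<^sup>2\<close>, \<open>c = -C\<^sup>2\<close> and \<open>c = 0\<close>. In each case the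
  two coefficients of the general solution are, up to a factor, constants of motion: expressions
  in \<open>u\<close>, \<open>y\<close> and \<open>y'\<close> with zero derivative.
\<close>

lemma oscillator_solution:
  fixes y y1 :: "real \<Rightarrow> real"
  assumes I: "is_interval I" and "C \<noteq> 0"
    and y: "\<And>u. u \<in> I \<Longrightarrow> (y has_real_derivative y1 u) (at u)"
      "\<And>u. u \<in> I \<Longrightarrow> (y1 has_real_derivative - (C\<^sup>2) * y u) (at u)"
  obtains A B where "\<And>u. u \<in> I \<Longrightarrow> y u = A * sin (C * u) + B * cos (C * u)"
    "\<And>u. u \<in> I \<Longrightarrow> y1 u = C * (A * cos (C * u) - B * sin (C * u))"
proof -
  have "((\<lambda>u. y u * sin (C * u) + y1 u * cos (C * u) / C) has_real_derivative 0) (at u)"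
    if u: "u \<in> I" for u
    using \<open>C \<noteq> 0\<close>
    by (auto intro!: derivative_eq_intros y[OF u] simp: field_simps power2_eq_square)
  from constant_on_open_interval[OF I this]
  obtain A where A: "\<forall>u\<in>I. y u * sin (C * u) + y1 u * cos (C * u) / C = A" ..
  have "((\<lambda>u. y u * cos (C * u) - y1 u * sin (C * u) / C) has_real_derivative 0) (at u)"
    if u: "u \<in> I" for u
    using \<open>C \<noteq> 0\<close>
    by (auto intro!: derivative_eq_intros y[OF u] simp: field_simps power2_eq_square)
  from constant_on_open_interval[OF I this]
  obtain B where B: "\<forall>u\<in>I. y u * cos (C * u) - y1 u * sin (C * u) / C = B" ..
  have *: "y u = A * sin (C * u) + B * cos (C * u) \<and> y1 u / C = A * cos (C * u) - B * sin (C * u)"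
    if u: "u \<in> I" for u
    unfolding A[rule_format, OF u, symmetric] B[rule_format, OF u, symmetric] 
    using sin_cos_squared_add[of "C * u"] unfolding times_divide_eq_left[symmetric] by algebra
  show ?thesis
    by (rule that[of A B]) (use * \<open>C \<noteq> 0\<close> in \<open>auto simp: field_simps\<close>)
qed

lemma hyperbolic_solution:
  fixes y y1 :: "real \<Rightarrow> real"
  assumes I: "is_interval I" and "C \<noteq> 0"
    and y: "\<And>u. u \<in> I \<Longrightarrow> (y has_real_derivative y1 u) (at u)"
      "\<And>u. u \<in> I \<Longrightarrow> (y1 has_real_derivative C\<^sup>2 * y u) (at u)"
  obtains A B where "\<And>u. u \<in> I \<Longrightarrow> y u = A * exp (C * u) + B * exp (- C * u)"
    "\<And>u. u \<in> I \<Longrightarrow> y1 u = C * (A * exp (C * u) - B * exp (- C * u))"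
proof -
  have "((\<lambda>u. (y u + y1 u / C) * exp (- C * u)) has_real_derivative 0) (at u)"
    if u: "u \<in> I" for u
    using \<open>C \<noteq> 0\<close>
    by (auto intro!: derivative_eq_intros y[OF u] simp: field_simps power2_eq_square)
  from constant_on_open_interval[OF I this]
  obtain A where A: "\<forall>u\<in>I. (y u + y1 u / C) * exp (- C * u) = A" ..
  have "((\<lambda>u. (y u - y1 u / C) * exp (C * u)) has_real_derivative 0) (at u)"
    if u: "u \<in> I" for u
    using \<open>C \<noteq> 0\<close>
    by (auto intro!: derivative_eq_intros y[OF u] simp: field_simps power2_eq_square)
  from constant_on_open_interval[OF I this]
  obtain B where B: "\<forall>u\<in>I. (y u - y1 u / C) * exp (C * u) = B" ..
  have *: "y u = A / 2 * exp (C * u) + B / 2 * exp (- C * u)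
      \<and> y1 u = C * (A / 2 * exp (C * u) - B / 2 * exp (- C * u))"
    if u: "u \<in> I" for u
    unfolding A[rule_format, OF u, symmetric] B[rule_format, OF u, symmetric]
    using \<open>C \<noteq> 0\<close> by (simp add: exp_minus field_simps)
  show ?thesis
    by (rule that[of "A / 2" "B / 2"]) (use * in auto)
qed

lemma affine_solution:
  fixes y y1 :: "real \<Rightarrow> real"
  assumes I: "is_interval I"
    and y: "\<And>u. u \<in> I \<Longrightarrow> (y has_real_derivative y1 u) (at u)"
      "\<And>u. u \<in> I \<Longrightarrow> (y1 has_real_derivative 0) (at u)"
  obtains A B where "\<And>u. u \<in> I \<Longrightarrow> y u = A * u + B" "\<And>u. u \<in> I \<Longrightarrow> y1 u = A"
proof -
  from constant_on_open_interval[OF I y(2)]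
  obtain A where A: "\<forall>u\<in>I. y1 u = A" ..
  have "((\<lambda>u. y u - A * u) has_real_derivative 0) (at u)" if u: "u \<in> I" for u
    by (auto intro!: derivative_eq_intros y(1)[OF u] simp: A[rule_format, OF u])
  from constant_on_open_interval[OF I this]
  obtain B where "\<forall>u\<in>I. y u - A * u = B" ..
  then show ?thesis
    by (intro that[of A B]) (auto simp: A algebra_simps)
qed

section \<open>Classification of constant curvature\<close>

lemma polar_form_cong:
  assumes "\<And>u. u \<in> I \<Longrightarrow> R u = R' u" "\<And>u. u \<in> I \<Longrightarrow> S u = S' u"
  shows "polar_form I \<alpha> f g R S \<longleftrightarrow> polar_form I \<alpha> f g R' S'"
  using assms by (simp add: polar_form_def cong: ball_cong)

theorem corollary3p4:
  fixes I :: "real set" and \<alpha> \<beta> :: real and f g :: "real \<Rightarrow> real"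
  assumes interval: "open I" "is_interval I" "I \<noteq> {}"
    and rates: "\<alpha> > 0" "\<beta> > 0"
    and smooth: "C2_on I f" "C2_on I g"
    and arc_length: "\<And>u. u \<in> I \<Longrightarrow> norm (vector_derivative (meridian f g) (at u)) = 1"
    and off_origin: "\<And>u. u \<in> I \<Longrightarrow> (f u)\<^sup>2 + (g u)\<^sup>2 \<noteq> 0"
    and equal_rates: "\<alpha> = \<beta>"
  defines "K_eq \<equiv> \<lambda>c. \<forall>p. p $ 1 \<in> I \<longrightarrow> gauss_curvature (rotational_surface \<alpha> \<beta> f g) p = c"
    and "case1 \<equiv> \<lambda>C. \<exists>C1 C2. polar_form I \<alpha> f g
           (\<lambda>u. C1 * sin (C * u) + C2 * cos (C * u))
           (\<lambda>u. \<alpha>\<^sup>2 - C\<^sup>2 * (C1 * cos (C * u) - C2 * sin (C * u))\<^sup>2)"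
    and "case2 \<equiv> \<lambda>C. \<exists>C1 C2. polar_form I \<alpha> f g
           (\<lambda>u. C1 * exp (C * u) + C2 * exp (- C * u))
           (\<lambda>u. \<alpha>\<^sup>2 - C\<^sup>2 * (C1 * exp (C * u) - C2 * exp (- C * u))\<^sup>2)"
    and "case3 \<equiv> \<exists>C1 C2. \<bar>C1\<bar> \<le> \<alpha> \<and> (\<forall>u\<in>I. C1 * u + C2 \<noteq> 0) \<and>
           polar_form I \<alpha> f g (\<lambda>u. C1 * u + C2) (\<lambda>u. \<alpha>\<^sup>2 - C1\<^sup>2)"
  shows "((\<exists>c. K_eq c) \<longleftrightarrow> (\<exists>C. C \<noteq> 0 \<and> case1 C) \<or> (\<exists>C. C \<noteq> 0 \<and> case2 C) \<or> case3) \<and>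
         (\<forall>C. C \<noteq> 0 \<longrightarrow> (K_eq (C\<^sup>2) \<longleftrightarrow> case1 C)) \<and>
         (\<forall>C. C \<noteq> 0 \<longrightarrow> (K_eq (- (C\<^sup>2)) \<longleftrightarrow> case2 C)) \<and>
         (K_eq 0 \<longleftrightarrow> case3)"
proof -
  have K: "K_eq c \<longleftrightarrow>
    (\<exists>R R1. (\<forall>u\<in>I. (R has_real_derivative R1 u) (at u)
                \<and> (R1 has_real_derivative - c * R u) (at u))
          \<and> polar_form I \<alpha> f g R (\<lambda>u. \<alpha>\<^sup>2 - (R1 u)\<^sup>2))" for c
    unfolding K_eq_def equal_rates[symmetric]
    by (rule constant_curvature_iff_polar_form
        [OF interval(1,2) rates(1) smooth arc_length off_origin])
  have K_pos: "K_eq (C\<^sup>2) \<longleftrightarrow> case1 C" if C: "C \<noteq> 0" for C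
  proof
    assume "K_eq (C\<^sup>2)"
    then obtain R R1 where R: "\<And>u. u \<in> I \<Longrightarrow> (R has_real_derivative R1 u) (at u)"
        "\<And>u. u \<in> I \<Longrightarrow> (R1 has_real_derivative - (C\<^sup>2) * R u) (at u)"
      and P: "polar_form I \<alpha> f g R (\<lambda>u. \<alpha>\<^sup>2 - (R1 u)\<^sup>2)"
      unfolding K by auto
    obtain A B where AB: "\<And>u. u \<in> I \<Longrightarrow> R u = A * sin (C * u) + B * cos (C * u)"
        "\<And>u. u \<in> I \<Longrightarrow> R1 u = C * (A * cos (C * u) - B * sin (C * u))"
      using oscillator_solution[OF interval(2) C R] by metis
    show "case1 C"
      unfolding case1_def
      by (intro exI[of _ A] exI[of _ B],
          rule iffD1[OF polar_form_cong P]) (simp_all add: AB power_mult_distrib)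
  next
    assume "case1 C"
    then obtain A B where P: "polar_form I \<alpha> f g (\<lambda>u. A * sin (C * u) + B * cos (C * u))
           (\<lambda>u. \<alpha>\<^sup>2 - C\<^sup>2 * (A * cos (C * u) - B * sin (C * u))\<^sup>2)"
      unfolding case1_def by blast
    show "K_eq (C\<^sup>2)"
      unfolding K
    proof (intro exI conjI ballI)
      show "polar_form I \<alpha> f g (\<lambda>u. A * sin (C * u) + B * cos (C * u))
           (\<lambda>u. \<alpha>\<^sup>2 - (C * (A * cos (C * u) - B * sin (C * u)))\<^sup>2)"
        using P by (simp add: power_mult_distrib)
    qed (auto intro!: derivative_eq_intros simp: algebra_simps power2_eq_square)
  qed
  have K_neg: "K_eq (- (C\<^sup>2)) \<longleftrightarrow> case2 C" if C: "C \<noteq> 0" for C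
  proof
    assume "K_eq (- (C\<^sup>2))"
    then obtain R R1 where R: "\<And>u. u \<in> I \<Longrightarrow> (R has_real_derivative R1 u) (at u)"
        "\<And>u. u \<in> I \<Longrightarrow> (R1 has_real_derivative C\<^sup>2 * R u) (at u)"
      and P: "polar_form I \<alpha> f g R (\<lambda>u. \<alpha>\<^sup>2 - (R1 u)\<^sup>2)"
      unfolding K by auto
    obtain A B where AB: "\<And>u. u \<in> I \<Longrightarrow> R u = A * exp (C * u) + B * exp (- C * u)"
        "\<And>u. u \<in> I \<Longrightarrow> R1 u = C * (A * exp (C * u) - B * exp (- C * u))"
      using hyperbolic_solution[OF interval(2) C R] by metis
    show "case2 C"
      unfolding case2_def
      by (intro exI[of _ A] exI[of _ B],
          rule iffD1[OF polar_form_cong P]) (simp_all add: AB power_mult_distrib)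
  next
    assume "case2 C"
    then obtain A B where P: "polar_form I \<alpha> f g (\<lambda>u. A * exp (C * u) + B * exp (- C * u))
           (\<lambda>u. \<alpha>\<^sup>2 - C\<^sup>2 * (A * exp (C * u) - B * exp (- C * u))\<^sup>2)"
      unfolding case2_def by blast
    show "K_eq (- (C\<^sup>2))"
      unfolding K
    proof (intro exI conjI ballI)
      show "polar_form I \<alpha> f g (\<lambda>u. A * exp (C * u) + B * exp (- C * u))
           (\<lambda>u. \<alpha>\<^sup>2 - (C * (A * exp (C * u) - B * exp (- C * u)))\<^sup>2)"
        using P by (simp add: power_mult_distrib)
    qed (auto intro!: derivative_eq_intros simp: algebra_simps power2_eq_square)
  qed
  have K_zero: "K_eq 0 \<longleftrightarrow> case3"
  proof
    assume "K_eq 0"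
    then obtain R R1 where R: "\<And>u. u \<in> I \<Longrightarrow> (R has_real_derivative R1 u) (at u)"
        "\<And>u. u \<in> I \<Longrightarrow> (R1 has_real_derivative 0) (at u)"
      and P: "polar_form I \<alpha> f g R (\<lambda>u. \<alpha>\<^sup>2 - (R1 u)\<^sup>2)"
      unfolding K by auto
    obtain A B where AB: "\<And>u. u \<in> I \<Longrightarrow> R u = A * u + B" "\<And>u. u \<in> I \<Longrightarrow> R1 u = A"
      using affine_solution[OF interval(2) R] by metis
    have P': "polar_form I \<alpha> f g (\<lambda>u. A * u + B) (\<lambda>u. \<alpha>\<^sup>2 - A\<^sup>2)"
      by (rule iffD1[OF polar_form_cong P]) (simp_all add: AB)
    then have "\<forall>u\<in>I. A * u + B \<noteq> 0" "A\<^sup>2 \<le> \<alpha>\<^sup>2"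
      using interval(3) by (auto simp: polar_form_def)
    moreover from this(2) have "\<bar>A\<bar> \<le> \<alpha>"
      using rates(1) by (simp add: abs_le_square_iff[symmetric])
    ultimately show case3
      unfolding case3_def using P' by blast
  next
    assume case3
    then obtain A B where P: "polar_form I \<alpha> f g (\<lambda>u. A * u + B) (\<lambda>u. \<alpha>\<^sup>2 - A\<^sup>2)"
      unfolding case3_def by blast
    show "K_eq 0"
      unfolding K
    proof (intro exI conjI ballI)
      show "polar_form I \<alpha> f g (\<lambda>u. A * u + B) (\<lambda>u. \<alpha>\<^sup>2 - A\<^sup>2)" by (rule P)
    qed (auto intro!: derivative_eq_intros)
  qed
  have "(\<exists>c. K_eq c) \<longleftrightarrow> (\<exists>C. C \<noteq> 0 \<and> case1 C) \<or> (\<exists>C. C \<noteq> 0 \<and> case2 C) \<or> case3"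
  proof
    assume "\<exists>c. K_eq c"
    then obtain c where c: "K_eq c" ..
    consider "c > 0" | "c < 0" | "c = 0" by linarith
    then show "(\<exists>C. C \<noteq> 0 \<and> case1 C) \<or> (\<exists>C. C \<noteq> 0 \<and> case2 C) \<or> case3"
    proof cases
      case 1
      then have "sqrt c \<noteq> 0" "case1 (sqrt c)" using K_pos[of "sqrt c"] c by auto
      then show ?thesis by blast
    next
      case 2
      then have "sqrt (- c) \<noteq> 0" "case2 (sqrt (- c))" using K_neg[of "sqrt (- c)"] c by auto
      then show ?thesis by blast
    next
      case 3
      then show ?thesis using K_zero c by auto
    qed
  qed (use K_pos K_neg K_zero in blast)
  then show ?thesis
    using K_pos K_neg K_zero by blast
qed

end
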